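(* Let $g_1,g_2,\dots$ be real numbers that eventually vanish, i.e. for some $n_0$ we have $g_{n_0}=g_{n_0+1}=\dots=0$. Put $\overline{g}_n:=\frac1n(g_1+\dots+g_n)$, and let $a\in\mathbb{R}$ satisfy $a>-2\inf_{n\ge1}\overline{g}_n$. Let $$0=\xi_1<\xi_2<\xi_3<\dots$$ be a random configuration of points in $\mathbb{R}_+=[0,\infty)$ whose gap sequence satisfies $(\zeta_k:=\xi_{k+1}-\xi_k)_{k=1}^\infty\sim\pi_a$, where $\pi_a:=\bigotimes_{n=1}^\infty\mathrm{Exp}\big(2(g_1+\dots+g_n)+na\big)$. Let $N(x):=\#\{i\ge1 : \xi_i\le x\}$ be the random number of points in $[0,x]$. Then $$0<\liminf_{x\to\infty}e^{-ax}N(x)\le\limsup_{x\to\infty}e^{-ax}N(x)<\infty\quad\text{a.s.}$$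
   Context: $\mathrm{Exp}(\lambda)$ is the exponential distribution with density $\lambda e^{-\lambda x}$, $x>0$ (mean $\lambda^{-1}$); $\bigotimes$ denotes product measure, so $\pi_a$ is a probability measure on sequences of nonnegative real numbers under which the coordinates are independent. *)

theory Defs
  imports "HOL-Probability.Probability"
begin

(* Sequences g_1, g_2, ..., gaps and points are functions on nat that are only
   looked at on {1..}; their value at 0 is irrelevant. *)

definition gbar :: "(nat \<Rightarrow> real) \<Rightarrow> nat \<Rightarrow> real" where
  "gbar g n = (\<Sum>i=1..n. g i) / real n"

(* Meaningful for l > 0 only. *)
definition Exp_dist :: "real \<Rightarrow> real measure" where
  "Exp_dist l = density lborel (\<lambda>x. ennreal (exponential_density l x))"

definition pi_measure :: "(nat \<Rightarrow> real) \<Rightarrow> real \<Rightarrow> (nat \<Rightarrow> real) measure" where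
  "pi_measure g a =
     (\<Pi>\<^sub>M n\<in>{1..}. Exp_dist (2 * (\<Sum>i=1..n. g i) + real n * a))"

definition gap_seq :: "(nat \<Rightarrow> real) \<Rightarrow> nat \<Rightarrow> real" where
  "gap_seq p = (\<lambda>k\<in>{1..}. p (k + 1) - p k)"

(* The counting measure, rather than card, so that the count is infinite
   (and not 0) should infinitely many points lie in [0,x]. *)
definition num_points :: "(nat \<Rightarrow> real) \<Rightarrow> real \<Rightarrow> ennreal" where
  "num_points p x = emeasure (count_space UNIV) {i. 1 \<le> i \<and> p i \<le> x}"

end

(* The rates are l_n = a n + O(1) with a > 0, so the mean of xi_n is (ln n) / a + O(1). The centred
   gaps in the dyadic block [2^j, 2^(j+1)) are independent with variances O(4^(-j)), so the block
   sums are O(2^(-j/2)) in L^2 and almost surely absolutely summable; hence a xi_n - ln n is almost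
   surely bounded along n = 2^j. Since xi is monotone and ln (2^(j+1)) - ln (2^j) is bounded, no
   maximal inequality is needed to extend this to all n, and inverting a xi_n = ln n + O(1) gives
   N(x) = exp (a x) up to constant factors. *)
theory Submission
  imports Defs "HOL-Real_Asymp.Real_Asymp"
begin

section \<open>Second moments and almost sure summability over dyadic blocks\<close>

lemma (in prob_space) second_moment_sum_indep_centered:
  fixes X :: "'i \<Rightarrow> 'a \<Rightarrow> real"
  assumes "finite I" and indep: "indep_vars (\<lambda>_. borel) X I"
    and int: "\<And>i. i \<in> I \<Longrightarrow> integrable M (X i)"
    and sq: "\<And>i. i \<in> I \<Longrightarrow> integrable M (\<lambda>\<omega>. (X i \<omega>)\<^sup>2)"
    and mean: "\<And>i. i \<in> I \<Longrightarrow> expectation (X i) = 0"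
  shows "has_bochner_integral M (\<lambda>\<omega>. (\<Sum>i\<in>I. X i \<omega>)\<^sup>2) (\<Sum>i\<in>I. expectation (\<lambda>\<omega>. (X i \<omega>)\<^sup>2))"
proof -
  \<comment> \<open>After the square is expanded into a double sum, each off-diagonal term
    factorises by independence into a product of zero means, so only the diagonal survives.\<close>
  have "has_bochner_integral M (\<lambda>\<omega>. X i \<omega> * X j \<omega>)
      (if i = j then expectation (\<lambda>\<omega>. (X i \<omega>)\<^sup>2) else 0)" if "i \<in> I" "j \<in> I" for i j
  proof (cases "i = j")
    case True
    then show ?thesis
      using sq that by (simp add: has_bochner_integral_iff power2_eq_square)
  next
    case False
    have *: "indep_vars (\<lambda>_. borel) X {i, j}"
      using indep_vars_subset[OF indep] that by simp
    have "integrable M (\<lambda>\<omega>. \<Prod>k\<in>{i, j}. X k \<omega>)"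
      by (rule indep_vars_integrable[OF _ *]) (use int that in auto)
    moreover have "expectation (\<lambda>\<omega>. \<Prod>k\<in>{i, j}. X k \<omega>) = (\<Prod>k\<in>{i, j}. expectation (X k))"
      by (rule indep_vars_lebesgue_integral[OF _ *]) (use int that in auto)
    ultimately show ?thesis
      using False mean that by (simp add: has_bochner_integral_iff)
  qed
  then have "has_bochner_integral M (\<lambda>\<omega>. \<Sum>i\<in>I. \<Sum>j\<in>I. X i \<omega> * X j \<omega>)
      (\<Sum>i\<in>I. \<Sum>j\<in>I. if i = j then expectation (\<lambda>\<omega>. (X i \<omega>)\<^sup>2) else 0)"
    by (intro has_bochner_integral_sum)
  then show ?thesis
    using \<open>finite I\<close> by (simp add: power2_eq_square sum_product)
qed

text \<open>A form of AM-GM from expanding \<open>(t * \<bar>x\<bar> - 1)\<^sup>2\<close>, with a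
  factor 2 given away. It turns a second-moment bound into a first-moment bound, with a weight
  \<open>t\<close> that may vary from block to block.\<close>

lemma abs_le_scaled_square:
  fixes x t :: real
  assumes "t > 0"
  shows "\<bar>x\<bar> \<le> t * x\<^sup>2 + 1 / t"
proof -
  have "0 \<le> (t * \<bar>x\<bar> - 1)\<^sup>2 + t * \<bar>x\<bar>"
    using assms by simp
  also have "\<dots> \<le> t\<^sup>2 * x\<^sup>2 + 1 - t * \<bar>x\<bar>"
    by (simp add: power2_diff power_mult_distrib)
  finally have "t * \<bar>x\<bar> \<le> t\<^sup>2 * x\<^sup>2 + 1"
    by simp
  then have "\<bar>x\<bar> \<le> (t\<^sup>2 * x\<^sup>2 + 1) / t"
    using assms by (simp add: pos_le_divide_eq mult.commute)
  also have "\<dots> = t * x\<^sup>2 + 1 / t"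
    using assms by (simp add: add_divide_distrib power2_eq_square)
  finally show ?thesis .
qed

lemma sum_dyadic_blocks:
  fixes f :: "nat \<Rightarrow> 'a :: comm_monoid_add"
  shows "(\<Sum>k\<in>{1..<2^n}. f k) = (\<Sum>j<n. \<Sum>k\<in>{2^j..<2^Suc j}. f k)"
proof (induction n)
  case (Suc n)
  have "{1..<2 ^ Suc n} = {1..<2^n} \<union> {2^n..<2^Suc n :: nat}"
    by (subst ivl_disj_un) auto
  then show ?case
    using Suc by (simp add: sum.union_disjoint del: power_Suc)
qed simp

text \<open>The expectation of the whole series is finite: sum and integral are interchanged for
  nonnegative terms, and each \<open>\<bar>D j\<bar>\<close> has expectation at most a summable
  \<open>u j\<close>. A nonnegative variable with finite expectation is almost surely
  finite.\<close>

lemma (in prob_space) AE_summable_if_second_moments_geometric: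
  fixes D :: "nat \<Rightarrow> 'a \<Rightarrow> real"
  assumes int: "\<And>j. integrable M (\<lambda>\<omega>. (D j \<omega>)\<^sup>2)"
    and [measurable]: "\<And>j. D j \<in> borel_measurable M"
    and bound: "\<And>j. expectation (\<lambda>\<omega>. (D j \<omega>)\<^sup>2) \<le> C / 2^j"
  shows "AE \<omega> in M. summable (\<lambda>j. \<bar>D j \<omega>\<bar>)"
proof -
  have "0 \<le> C"
    using order_trans[OF integral_nonneg_AE bound[of 0]] by simp
  txt \<open>The weight 3/2 is any number strictly between 1 and 2: \<open>t D\<^sup>2 + 1 / t\<close> with
    \<open>t = (3/2)\<^sup>j\<close> has summable expectation.\<close>
  define u where "u j = (3/2)^j * (C / 2^j) + 1 / (3/2)^j" for j :: nat
  have "u = (\<lambda>j. C * (3/4)^j + (2/3)^j)"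
    by (simp add: u_def fun_eq_iff power_divide field_simps flip: power_mult_distrib)
  then have u: "summable u" "\<And>j. 0 \<le> u j"
    using \<open>0 \<le> C\<close> by (auto intro!: summable_add summable_mult summable_geometric)
  have "(\<integral>\<^sup>+\<omega>. ennreal \<bar>D j \<omega>\<bar> \<partial>M) \<le> ennreal (u j)" for j
  proof -
    have "(\<integral>\<^sup>+\<omega>. ennreal \<bar>D j \<omega>\<bar> \<partial>M) \<le> (\<integral>\<^sup>+\<omega>. ennreal ((3/2)^j * (D j \<omega>)\<^sup>2 + 1 / (3/2)^j) \<partial>M)"
      by (intro nn_integral_mono ennreal_leI abs_le_scaled_square) simp
    also have "\<dots> = ennreal (expectation (\<lambda>\<omega>. (3/2)^j * (D j \<omega>)\<^sup>2 + 1 / (3/2)^j))"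
      by (intro nn_integral_eq_integral) (use int in auto)
    also have "\<dots> \<le> ennreal (u j)"
      using int mult_left_mono[OF bound[of j], of "(3/2)^j"]
      by (intro ennreal_leI) (simp add: u_def prob_space)
    finally show ?thesis .
  qed
  then have "(\<integral>\<^sup>+\<omega>. (\<Sum>j. ennreal \<bar>D j \<omega>\<bar>) \<partial>M) \<le> (\<Sum>j. ennreal (u j))"
    by (subst nn_integral_suminf) (auto intro!: suminf_le)
  also have "\<dots> < \<infinity>"
    using u by (simp add: suminf_ennreal2)
  finally have "AE \<omega> in M. (\<Sum>j. ennreal \<bar>D j \<omega>\<bar>) \<noteq> \<infinity>"
    by (intro nn_integral_PInf_AE) auto
  then show ?thesis
    by (auto elim!: eventually_mono intro: summable_suminf_not_top)
qed

text \<open>Block \<open>j\<close> has \<open>2^j\<close> terms, each of variance at most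
  \<open>C / 4^j\<close>, so its sum has second moment at most \<open>C / 2^j\<close>. The previous
  lemma makes the block sums absolutely summable, and their total is the bound
  \<open>B\<close>.\<close>

lemma (in prob_space) AE_dyadic_sums_bounded:
  fixes X :: "nat \<Rightarrow> 'a \<Rightarrow> real"
  assumes indep: "indep_vars (\<lambda>_. borel) X {1..}"
    and int: "\<And>k. 1 \<le> k \<Longrightarrow> integrable M (X k)"
    and sq: "\<And>k. 1 \<le> k \<Longrightarrow> integrable M (\<lambda>\<omega>. (X k \<omega>)\<^sup>2)"
    and mean: "\<And>k. 1 \<le> k \<Longrightarrow> expectation (X k) = 0"
    and bound: "\<And>k. 1 \<le> k \<Longrightarrow> expectation (\<lambda>\<omega>. (X k \<omega>)\<^sup>2) \<le> C / (real k)\<^sup>2"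
  shows "AE \<omega> in M. \<exists>B. \<forall>n. \<bar>\<Sum>k\<in>{1..<2^n}. X k \<omega>\<bar> \<le> B"
proof -
  define D where "D j \<omega> = (\<Sum>k\<in>{2^j..<2^Suc j}. X k \<omega>)" for j \<omega>
  \<comment> \<open>Read off from \<open>k = 1\<close>. The sign matters below, where
    \<open>k\<close> is replaced by the smaller \<open>2^j\<close> in the denominator.\<close>
  have "0 \<le> C"
    using order_trans[OF integral_nonneg_AE bound[of 1]] by simp
  have ge1: "1 \<le> k" if "k \<in> {2^j..<2^Suc j}" for j k :: nat
    using that order_trans[of 1 "2^j" k] by simp
  have D: "has_bochner_integral M (\<lambda>\<omega>. (D j \<omega>)\<^sup>2)
      (\<Sum>k\<in>{2^j..<2^Suc j}. expectation (\<lambda>\<omega>. (X k \<omega>)\<^sup>2))" for j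
    unfolding D_def
    by (intro second_moment_sum_indep_centered indep_vars_subset[OF indep] int sq mean)
      (use ge1 in auto)
  have "(\<Sum>k\<in>{2^j..<2^Suc j}. expectation (\<lambda>\<omega>. (X k \<omega>)\<^sup>2)) \<le> C / 2^j" for j
  proof -
    have "(\<Sum>k\<in>{2^j..<2^Suc j}. expectation (\<lambda>\<omega>. (X k \<omega>)\<^sup>2)) \<le> (\<Sum>k\<in>{2^j..<2^Suc j::nat}. C / (2^j)\<^sup>2)"
    proof (intro sum_mono)
      fix k :: nat assume k: "k \<in> {2^j..<2^Suc j}"
      have "(2^j :: real) \<le> real k"
        using k by (metis atLeastLessThan_iff of_nat_le_iff of_nat_numeral of_nat_power)
      then have "C / (real k)\<^sup>2 \<le> C / (2^j)\<^sup>2"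
        using \<open>0 \<le> C\<close> by (intro divide_left_mono power_mono mult_pos_pos zero_less_power) (auto intro: less_le_trans[of _ "2^j"])
      then show "expectation (\<lambda>\<omega>. (X k \<omega>)\<^sup>2) \<le> C / (2^j)\<^sup>2"
        using bound[OF ge1[OF k]] by simp
    qed
    also have "\<dots> = C / 2^j"
      by (simp add: power2_eq_square)
    finally show ?thesis .
  qed
  then have "AE \<omega> in M. summable (\<lambda>j. \<bar>D j \<omega>\<bar>)"
    using D int ge1 by (intro AE_summable_if_second_moments_geometric)
      (auto simp: has_bochner_integral_iff D_def intro!: borel_measurable_sum)
  then show ?thesis
  proof eventually_elim
    case (elim \<omega>)
    have "\<bar>\<Sum>k\<in>{1..<2^n}. X k \<omega>\<bar> \<le> (\<Sum>j. \<bar>D j \<omega>\<bar>)" for n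
    proof -
      have "\<bar>\<Sum>k\<in>{1..<2^n}. X k \<omega>\<bar> \<le> (\<Sum>j<n. \<bar>D j \<omega>\<bar>)"
        unfolding sum_dyadic_blocks D_def by (rule sum_abs)
      also have "\<dots> \<le> (\<Sum>j. \<bar>D j \<omega>\<bar>)"
        using elim by (intro sum_le_suminf) auto
      finally show ?thesis .
    qed
    then show ?case by blast
  qed
qed

section \<open>Deterministic estimates: mean positions, dyadic interpolation, counting\<close>

lemma sum_inverse_affine_ln_bounded:
  fixes a c :: real and l :: "nat \<Rightarrow> real"
  assumes "a > 0" and l: "\<forall>\<^sub>F k in sequentially. l k = a * real k + c"
  obtains C where "\<And>n. 1 \<le> n \<Longrightarrow> \<bar>a * (\<Sum>k\<in>{1..<n}. 1 / l k) - ln (real n)\<bar> \<le> C"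
proof -
  \<comment> \<open>Both \<open>a / l k\<close> and the increment of \<open>ln\<close> at
    \<open>k\<close> equal \<open>1 / k\<close> up to O(1/k^2), so the errors \<open>e\<close> are
    absolutely summable. The finitely many \<open>k\<close> at which \<open>l\<close> is not yet
    affine affect only the constant.\<close>
  define e where "e k = a / l k - (ln (real (Suc k)) - ln (real k))" for k
  have "(\<lambda>k. a / (a * real k + c) - (ln (real k + 1) - ln (real k))) \<in> O(\<lambda>k. 1 / (real k)\<^sup>2)"
    using \<open>a > 0\<close> by real_asymp
  also have "?this \<longleftrightarrow> e \<in> O(\<lambda>k. 1 / (real k)\<^sup>2)"
    by (intro landau_o.big.in_cong eventually_mono[OF l]) (simp add: e_def add_ac)
  finally have "e \<in> O(\<lambda>k. 1 / (real k)\<^sup>2)" .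
  then have "(\<lambda>k. norm (e k)) \<in> O(\<lambda>k. 1 / (real k)\<^sup>2)"
    by simp
  moreover have "summable (\<lambda>k. norm (1 / (real k)\<^sup>2))"
    using inverse_power_summable[of 2, where 'a = real] by (simp add: divide_inverse)
  ultimately have "summable (\<lambda>k. norm (e k))"
    by (rule summable_comparison_test_bigo[rotated])
  show ?thesis
  proof
    fix n :: nat assume "1 \<le> n"
    have "(\<Sum>k\<in>{1..<n}. ln (real (Suc k)) - ln (real k)) = ln (real n)"
      using sum_Suc_diff'[OF \<open>1 \<le> n\<close>, of "\<lambda>k. ln (real k)"] by (simp only: of_nat_1 ln_one diff_zero)
    then have "a * (\<Sum>k\<in>{1..<n}. 1 / l k) - ln (real n) = (\<Sum>k\<in>{1..<n}. e k)"
      unfolding e_def sum_subtractf by (simp only: sum_distrib_left times_divide_eq_right mult_1_right)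
    also have "\<bar>\<dots>\<bar> \<le> (\<Sum>k\<in>{1..<n}. norm (e k))"
      by (simp add: sum_abs)
    \<comment> \<open>The series also contains the index 0, where \<open>e\<close> takes a default
      value; its norm can only enlarge the bound.\<close>
    also have "\<dots> \<le> (\<Sum>k. norm (e k))"
      using \<open>summable (\<lambda>k. norm (e k))\<close> by (intro sum_le_suminf) auto
    finally show "\<bar>a * (\<Sum>k\<in>{1..<n}. 1 / l k) - ln (real n)\<bar> \<le> (\<Sum>k. norm (e k))" .
  qed
qed

text \<open>Between consecutive powers of two both \<open>S\<close> and \<open>ln\<close> are
  sandwiched by their values at the endpoints. The values of \<open>ln\<close> there differ by
  \<open>ln 2\<close>, which is the loss.\<close>

lemma ln_bounded_if_dyadic:
  fixes S :: "nat \<Rightarrow> real"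
  assumes mono: "\<And>m n. 1 \<le> m \<Longrightarrow> m \<le> n \<Longrightarrow> S m \<le> S n"
    and dyadic: "\<And>j. \<bar>S (2^j) - real j * ln 2\<bar> \<le> K"
    and "1 \<le> n"
  shows "\<bar>S n - ln (real n)\<bar> \<le> K + ln 2"
proof -
  obtain j where j: "2^j \<le> n" "n < 2^Suc j"
    using ex_power_ivl1[of 2 n] \<open>1 \<le> n\<close> by auto
  have "S (2^j) \<le> S n" "S n \<le> S (2^Suc j)"
    using j \<open>1 \<le> n\<close> by (auto intro!: mono simp del: power_Suc)
  moreover have "real (2^j) \<le> real n" "real n \<le> real (2^Suc j)"
    using j by (auto simp only: of_nat_le_iff)
  then have "ln (real (2^j)) \<le> ln (real n)" "ln (real n) \<le> ln (real (2^Suc j))"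
    using \<open>1 \<le> n\<close> by (subst ln_le_cancel_iff; simp)+
  then have "real j * ln 2 \<le> ln (real n)" "ln (real n) \<le> real (Suc j) * ln 2"
    by (simp_all add: ln_realpow del: power_Suc of_nat_Suc)
  ultimately show ?thesis
    using dyadic[of j] dyadic[of "Suc j"] by (simp add: algebra_simps abs_le_iff)
qed

text \<open>Inversion: \<open>p n \<le> x\<close> implies \<open>ln n \<le> a * x + C\<close> and
  follows from \<open>ln n \<le> a * x - C\<close>. So the counted indices lie between two initial
  segments whose lengths are \<open>exp (a * x - C)\<close> and \<open>exp (a * x + C)\<close>
  rounded down.\<close>

lemma num_points_growth:
  fixes p :: "nat \<Rightarrow> real"
  assumes "a > 0" and p: "\<And>n. 1 \<le> n \<Longrightarrow> \<bar>a * p n - ln (real n)\<bar> \<le> C"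
  defines "F \<equiv> \<lambda>x. ennreal (exp (- a * x)) * num_points p x"
  shows "0 < Liminf at_top F" and "Limsup at_top F < \<infinity>"
proof -
  have upper: "F x \<le> ennreal (exp C)" for x
  proof -
    have "{i. 1 \<le> i \<and> p i \<le> x} \<subseteq> {1..nat \<lfloor>exp (a * x + C)\<rfloor>}"
    proof safe
      fix i :: nat assume i: "1 \<le> i" "p i \<le> x"
      have "ln (real i) \<le> a * x + C"
        using p[OF i(1)] mult_left_mono[OF i(2), of a] \<open>a > 0\<close> by linarith
      then have "real i \<le> exp (a * x + C)"
        using i by (metis exp_le_cancel_iff exp_ln of_nat_0_less_iff less_le_trans zero_less_one)
      then show "i \<in> {1..nat \<lfloor>exp (a * x + C)\<rfloor>}"
        using i by (simp add: le_nat_floor)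
    qed
    then have "num_points p x \<le> emeasure (count_space UNIV) {1..nat \<lfloor>exp (a * x + C)\<rfloor>}"
      unfolding num_points_def by (intro emeasure_mono) auto
    also have "\<dots> \<le> ennreal (exp (a * x + C))"
      by (auto simp: ennreal_of_nat_eq_real_of_nat intro!: ennreal_leI)
    finally have "F x \<le> ennreal (exp (- a * x)) * ennreal (exp (a * x + C))"
      unfolding F_def by (rule mult_left_mono) simp
    then show ?thesis
      by (simp flip: ennreal_mult exp_add)
  qed
  have "Limsup at_top F \<le> ennreal (exp C)"
    by (intro Limsup_bounded always_eventually allI upper)
  then show "Limsup at_top F < \<infinity>"
    by (rule le_less_trans) simp
  \<comment> \<open>The threshold on \<open>x\<close> makes \<open>exp (a * x - C)\<close> at least
    2, so that rounding it down to \<open>m\<close> loses at most half of it.\<close>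
  have lower: "ennreal (exp (- C) / 2) \<le> F x" if "x \<ge> (C + ln 2) / a" for x
  proof -
    define m where "m = nat \<lfloor>exp (a * x - C)\<rfloor>"
    have "a * x - C \<ge> ln 2"
      using that \<open>a > 0\<close> by (simp add: field_simps)
    then have "exp (a * x - C) \<ge> 2"
      by (metis exp_le_cancel_iff exp_ln zero_less_numeral)
    then have m: "exp (a * x - C) / 2 \<le> real m" "real m \<le> exp (a * x - C)"
      unfolding m_def by linarith+
    have "{1..m} \<subseteq> {i. 1 \<le> i \<and> p i \<le> x}"
    proof safe
      fix i assume i: "i \<in> {1..m}"
      then have "ln (real i) \<le> a * x - C"
        using m by (subst exp_le_cancel_iff[symmetric]) simp
      then have "a * p i \<le> a * x"
        using p[of i] i by (simp add: abs_le_iff)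
      then show "p i \<le> x"
        using \<open>a > 0\<close> by simp
    qed auto
    then have "emeasure (count_space UNIV) {1..m} \<le> num_points p x"
      unfolding num_points_def by (intro emeasure_mono) auto
    then have "ennreal (real m) \<le> num_points p x"
      by (simp add: ennreal_of_nat_eq_real_of_nat)
    with ennreal_leI[OF m(1)] have "ennreal (exp (a * x - C) / 2) \<le> num_points p x"
      by (rule order_trans)
    then have "ennreal (exp (- a * x)) * ennreal (exp (a * x - C) / 2) \<le> F x"
      unfolding F_def by (rule mult_left_mono) simp
    then show ?thesis
      by (simp add: exp_diff exp_minus field_simps flip: ennreal_mult)
  qed
  have "ennreal (exp (- C) / 2) \<le> Liminf at_top F"
    using lower by (intro Liminf_bounded) (auto simp: eventually_at_top_linorder)
  then show "0 < Liminf at_top F"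
    by (rule less_le_trans[rotated]) simp
qed


section \<open>Linear bounds on the rates\<close>

lemma rate_bounds:
  fixes g :: "nat \<Rightarrow> real"
  assumes g_vanish: "\<exists>n0\<ge>1. \<forall>n\<ge>n0. g n = 0"
    and a_bound: "a > - 2 * (INF n\<in>{1..}. gbar g n)"
  defines "l \<equiv> \<lambda>n. 2 * (\<Sum>i=1..n. g i) + real n * a"
  obtains d c where "d > 0" and "d \<le> a" and "\<And>n. 1 \<le> n \<Longrightarrow> d * real n \<le> l n"
    and "\<forall>\<^sub>F n in sequentially. l n = a * real n + c"
proof -
  obtain n0 where n0: "n0 \<ge> 1" "\<And>n. n \<ge> n0 \<Longrightarrow> g n = 0"
    using g_vanish by blast
  define G where "G = (\<Sum>i=1..n0. g i)"
  have G: "(\<Sum>i=1..n. g i) = G" if "n \<ge> n0" for n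
    unfolding G_def using that n0 by (intro sum.mono_neutral_right) auto
  \<comment> \<open>Since \<open>l n = n * (a + 2 * gbar g n)\<close>, this is the largest slope
    with \<open>d * n \<le> l n\<close> for all \<open>n \<ge> 1\<close>, and \<open>a_bound\<close>
    says exactly that it is positive.\<close>
  define d where "d = a + 2 * (INF n\<in>{1..}. gbar g n)"
  \<comment> \<open>A uniform bound, so that the real-valued \<open>INF\<close> is a genuine lower
    bound of the averages.\<close>
  have "\<bar>gbar g n\<bar> \<le> (\<Sum>i=1..n0. \<bar>g i\<bar>)" if "n \<ge> 1" for n
  proof -
    have "\<bar>gbar g n\<bar> \<le> \<bar>\<Sum>i=1..n. g i\<bar> / 1"
      unfolding gbar_def abs_divide using that by (intro divide_left_mono) auto
    also have "\<dots> \<le> (\<Sum>i=1..n. \<bar>g i\<bar>)"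
      by simp
    \<comment> \<open>Passing through \<open>max n n0\<close> treats \<open>n < n0\<close> and
      \<open>n \<ge> n0\<close> together.\<close>
    also have "\<dots> \<le> (\<Sum>i\<in>{1..max n n0}. \<bar>g i\<bar>)"
      by (intro sum_mono2) auto
    also have "\<dots> = (\<Sum>i=1..n0. \<bar>g i\<bar>)"
      using n0 by (intro sum.mono_neutral_right) auto
    finally show ?thesis .
  qed
  then have "bdd_below (gbar g ` {1..})"
    by (intro bdd_belowI2[of _ "- (\<Sum>i=1..n0. \<bar>g i\<bar>)"]) (simp add: abs_le_iff minus_le_iff)
  then have "(INF n\<in>{1..}. gbar g n) \<le> gbar g n" if "1 \<le> n" for n
    using that by (intro cINF_lower) auto
  then have ld: "d * real n \<le> l n" if "1 \<le> n" for n
    using that mult_right_mono[of "INF n\<in>{1..}. gbar g n" "gbar g n" "real n"]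
    by (simp add: d_def l_def gbar_def algebra_simps)
  have l: "l n = a * real n + 2 * G" if "n \<ge> n0" for n
    using G[OF that] by (simp add: l_def)
  \<comment> \<open>If \<open>d > a\<close>, the line \<open>d * n\<close> would overtake
    \<open>a * n + 2 * G\<close>, contradicting \<open>ld\<close>; \<open>max n n0\<close> is both
    past the crossing and in the affine range. With \<open>d > 0\<close> this yields
    \<open>a > 0\<close>, on which the main proof relies.\<close>
  have "d \<le> a"
  proof (rule ccontr)
    assume "\<not> d \<le> a"
    then obtain n where "2 * G / (d - a) < real n"
      using reals_Archimedean2 by blast
    then have "2 * G / (d - a) < real (max n n0)"
      by simp
    then have "a * real (max n n0) + 2 * G < d * real (max n n0)"
      using \<open>\<not> d \<le> a\<close> by (simp add: field_simps del: of_nat_max)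
    then show False
      using ld[of "max n n0"] l[of "max n n0"] n0 by (simp add: le_max_iff_disj)
  qed
  moreover have "d > 0"
    using a_bound by (simp add: d_def)
  ultimately show ?thesis
    using that[OF _ _ ld, of "2 * G"] l by (auto simp: eventually_at_top_linorder)
qed

section \<open>From the joint law of the gaps to independent exponential variables\<close>

lemma prob_space_Exp_dist: "0 < l \<Longrightarrow> prob_space (Exp_dist l)"
  unfolding Exp_dist_def by (rule prob_space_exponential_density)

lemma sets_Exp_dist [simp]: "sets (Exp_dist l) = sets borel"
  by (simp add: Exp_dist_def)

lemma (in prob_space) indep_vars_distr_if_joint_distr:
  fixes X :: "'i \<Rightarrow> 'a \<Rightarrow> 'b :: topological_space"
  assumes "I \<noteq> {}" and X: "\<And>i. i \<in> I \<Longrightarrow> X i \<in> borel_measurable M"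
    and prob: "\<And>i. i \<in> I \<Longrightarrow> prob_space (P i)" and sets: "\<And>i. i \<in> I \<Longrightarrow> sets (P i) = sets borel"
    and joint: "distr M (\<Pi>\<^sub>M i\<in>I. borel) (\<lambda>\<omega>. \<lambda>i\<in>I. X i \<omega>) = (\<Pi>\<^sub>M i\<in>I. P i)"
  shows "indep_vars (\<lambda>_. borel) X I" and "\<And>i. i \<in> I \<Longrightarrow> distr M borel (X i) = P i"
proof -
  show marginal: "distr M borel (X i) = P i" if "i \<in> I" for i
  proof -
    have "distr M borel (X i) = distr M borel ((\<lambda>x. x i) \<circ> (\<lambda>\<omega>. \<lambda>i\<in>I. X i \<omega>))"
      using that by (intro distr_cong) auto
    also have "\<dots> = distr (distr M (\<Pi>\<^sub>M i\<in>I. borel) (\<lambda>\<omega>. \<lambda>i\<in>I. X i \<omega>)) borel (\<lambda>x. x i)"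
      using X that by (intro distr_distr[symmetric] measurable_restrict) auto
    also have "\<dots> = distr (\<Pi>\<^sub>M i\<in>I. P i) (P i) (\<lambda>x. x i)"
      unfolding joint using sets that by (intro distr_cong) auto
    also have "\<dots> = P i"
      by (rule distr_PiM_component[OF prob that])
    finally show ?thesis .
  qed
  \<comment> \<open>With the marginals identified, \<open>joint\<close> says that the joint law is
    the product of the marginals, which characterises independence.\<close>
  have "(\<Pi>\<^sub>M i\<in>I. P i) = (\<Pi>\<^sub>M i\<in>I. distr M borel (X i))"
    by (intro PiM_cong) (simp_all add: marginal)
  then show "indep_vars (\<lambda>_. borel) X I"
    using assms(1) X joint by (subst indep_vars_iff_distr_eq_PiM') auto
qed

text \<open>The centred gap has variance \<open>1 / (l k)\<^sup>2\<close>, which the linear lower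
  bound on the rates turns into \<open>C / k\<^sup>2\<close> with
  \<open>C = 1 / d\<^sup>2\<close>.\<close>

lemma (in prob_space) AE_exponential_dyadic_sums_bounded:
  fixes Z :: "nat \<Rightarrow> 'a \<Rightarrow> real" and l :: "nat \<Rightarrow> real"
  assumes indep: "indep_vars (\<lambda>_. borel) Z {1..}"
    and Z: "\<And>k. 1 \<le> k \<Longrightarrow> distributed M lborel (Z k) (exponential_density (l k))"
    and "d > 0" and l: "\<And>k. 1 \<le> k \<Longrightarrow> d * real k \<le> l k"
  shows "AE \<omega> in M. \<exists>B. \<forall>n. \<bar>\<Sum>k\<in>{1..<2^n}. Z k \<omega> - 1 / l k\<bar> \<le> B"
proof (rule AE_dyadic_sums_bounded)
  show "indep_vars (\<lambda>_. borel) (\<lambda>k \<omega>. Z k \<omega> - 1 / l k) {1..}"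
    by (rule indep_vars_compose2[OF indep]) simp
  fix k :: nat assume k: "1 \<le> k"
  have dk: "0 < d * real k"
    using k \<open>d > 0\<close> by simp
  then have "0 < l k"
    using l[OF k] by simp
  \<comment> \<open>The exponential density is the Erlang density with parameter 0, so the Erlang
    moments apply.\<close>
  note int = erlang_ith_moment_integrable[OF \<open>0 < l k\<close> Z[OF k]]
  have [simp]: "integrable M (Z k)" "integrable M (\<lambda>\<omega>. (Z k \<omega>)\<^sup>2)"
    using int[of 1] int[of 2] by simp_all
  show "integrable M (\<lambda>\<omega>. Z k \<omega> - 1 / l k)" "integrable M (\<lambda>\<omega>. (Z k \<omega> - 1 / l k)\<^sup>2)"
    by (simp_all add: power2_diff)
  have mean: "expectation (Z k) = 1 / l k"
    using exponential_distributed_expectation[OF \<open>0 < l k\<close> Z[OF k]] .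
  then show "expectation (\<lambda>\<omega>. Z k \<omega> - 1 / l k) = 0"
    by (simp add: prob_space)
  have "expectation (\<lambda>\<omega>. (Z k \<omega> - 1 / l k)\<^sup>2) = 1 / (l k)\<^sup>2"
    using exponential_distributed_variance[OF \<open>0 < l k\<close> Z[OF k]] by (simp add: mean)
  also have "\<dots> \<le> 1 / (d * real k)\<^sup>2"
    using dk \<open>0 < l k\<close> l[OF k]
    by (intro divide_left_mono power_mono) (auto simp del: zero_less_mult_iff intro: mult_pos_pos zero_less_power)
  finally show "expectation (\<lambda>\<omega>. (Z k \<omega> - 1 / l k)\<^sup>2) \<le> (1 / d\<^sup>2) / (real k)\<^sup>2"
    by (simp add: power_mult_distrib)
qed

section \<open>Almost sure growth of the point configuration\<close>

theorem propositionA1: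
  fixes g :: "nat \<Rightarrow> real" and a :: real
    and M :: "'w measure" and \<xi> :: "nat \<Rightarrow> 'w \<Rightarrow> real"
  assumes g_vanish: "\<exists>n0\<ge>1. \<forall>n\<ge>n0. g n = 0"
    and a_bound: "a > - 2 * (INF n\<in>{1..}. gbar g n)"
    and prob: "prob_space M"
    and rv: "\<And>k. k \<ge> 1 \<Longrightarrow> \<xi> k \<in> borel_measurable M"
    and start: "\<And>\<omega>. \<omega> \<in> space M \<Longrightarrow> \<xi> 1 \<omega> = 0"
    and incr: "\<And>\<omega> k. \<omega> \<in> space M \<Longrightarrow> k \<ge> 1 \<Longrightarrow> \<xi> k \<omega> < \<xi> (k + 1) \<omega>"
    and gaps: "distr M (\<Pi>\<^sub>M k\<in>{1..}. borel) (\<lambda>\<omega>. gap_seq (\<lambda>k. \<xi> k \<omega>)) = pi_measure g a"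
  shows "AE \<omega> in M.
      0 < Liminf at_top (\<lambda>x::real. ennreal (exp (- a * x)) * num_points (\<lambda>k. \<xi> k \<omega>) x)
    \<and> Liminf at_top (\<lambda>x::real. ennreal (exp (- a * x)) * num_points (\<lambda>k. \<xi> k \<omega>) x)
        \<le> Limsup at_top (\<lambda>x::real. ennreal (exp (- a * x)) * num_points (\<lambda>k. \<xi> k \<omega>) x)
    \<and> Limsup at_top (\<lambda>x::real. ennreal (exp (- a * x)) * num_points (\<lambda>k. \<xi> k \<omega>) x) < \<infinity>"
proof -
  interpret prob_space M by (rule prob)
  define l where "l n = 2 * (\<Sum>i=1..n. g i) + real n * a" for n
  obtain d c where "d > 0" "d \<le> a" and ld: "\<And>n. 1 \<le> n \<Longrightarrow> d * real n \<le> l n"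
    and lc: "\<forall>\<^sub>F n in sequentially. l n = a * real n + c"
    using rate_bounds[OF g_vanish a_bound] unfolding l_def by blast
  have "a > 0"
    using \<open>d > 0\<close> \<open>d \<le> a\<close> by simp
  have l_pos: "0 < l n" if "1 \<le> n" for n
    using that \<open>d > 0\<close> by (intro less_le_trans[OF _ ld[OF that]] mult_pos_pos) auto
  define Z where "Z k \<omega> = \<xi> (k + 1) \<omega> - \<xi> k \<omega>" for k \<omega>
  have Z: "Z k \<in> borel_measurable M" if "k \<in> {1..}" for k
    unfolding Z_def using that by (intro borel_measurable_diff rv) auto
  have joint: "distr M (\<Pi>\<^sub>M k\<in>{1..}. borel) (\<lambda>\<omega>. \<lambda>k\<in>{1..}. Z k \<omega>) = (\<Pi>\<^sub>M k\<in>{1..}. Exp_dist (l k))"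
    using gaps by (simp add: gap_seq_def Z_def pi_measure_def l_def)
  have Exp: "prob_space (Exp_dist (l k))" if "k \<in> {1..}" for k
    using prob_space_Exp_dist[OF l_pos, of k] that by simp
  have "{1::nat..} \<noteq> {}"
    by simp
  note Z_laws = indep_vars_distr_if_joint_distr[OF this Z Exp sets_Exp_dist joint]
  have "indep_vars (\<lambda>_. borel) Z {1..}"
    by (rule Z_laws)
  moreover have "distributed M lborel (Z k) (exponential_density (l k))" if "1 \<le> k" for k
  proof -
    have k: "k \<in> {1..}"
      using that by simp
    \<comment> \<open>\<open>distributed\<close> takes the law on the reference measure
      \<open>lborel\<close>, which has the same sets as \<open>borel\<close>.\<close>
    have "distr M lborel (Z k) = distr M borel (Z k)"
      by (intro distr_cong) auto
    also have "\<dots> = Exp_dist (l k)"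
      using k by (intro Z_laws(2))
    finally show ?thesis
      using Z[OF k] by (simp add: distributed_def Exp_dist_def)
  qed
  ultimately have bounded: "AE \<omega> in M. \<exists>B. \<forall>n. \<bar>\<Sum>k\<in>{1..<2^n}. Z k \<omega> - 1 / l k\<bar> \<le> B"
    using \<open>d > 0\<close> ld by (rule AE_exponential_dyadic_sums_bounded)
  obtain C where C: "\<And>n. 1 \<le> n \<Longrightarrow> \<bar>a * (\<Sum>k\<in>{1..<n}. 1 / l k) - ln (real n)\<bar> \<le> C"
    using sum_inverse_affine_ln_bounded[OF \<open>a > 0\<close> lc] by blast
  show ?thesis
    \<comment> \<open>\<open>start\<close> and \<open>incr\<close> hold only for points of
      \<open>space M\<close>, hence \<open>AE_space\<close>.\<close>
    using bounded AE_space
  proof eventually_elim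
    case (elim \<omega>)
    then obtain B where B: "\<And>n. \<bar>\<Sum>k\<in>{1..<2^n}. Z k \<omega> - 1 / l k\<bar> \<le> B"
      by blast
    \<comment> \<open>Telescoping from \<open>\<xi> 1 \<omega> = 0\<close>; the sum stops at
      \<open>n - 1\<close> because \<open>Z k\<close> leads from point \<open>k\<close> to point
      \<open>k + 1\<close>.\<close>
    have \<xi>: "\<xi> n \<omega> = (\<Sum>k\<in>{1..<n}. Z k \<omega>)" if "1 \<le> n" for n
      using that start[of \<omega>] elim sum_Suc_diff'[of 1 n "\<lambda>k. \<xi> k \<omega>"] by (simp add: Z_def)
    \<comment> \<open>The three terms bound the random fluctuation at powers of two
      (\<open>B\<close> depends on \<open>\<omega>\<close>), the error of the means, and the loss
      from dyadic interpolation.\<close>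
    have "\<bar>a * \<xi> n \<omega> - ln (real n)\<bar> \<le> (a * B + C) + ln 2" if "1 \<le> n" for n
    proof (rule ln_bounded_if_dyadic[OF _ _ that])
      fix i j :: nat assume "1 \<le> i" "i \<le> j"
      have "\<xi> i \<omega> \<le> \<xi> j \<omega>"
        using \<open>i \<le> j\<close>
      proof (induction j rule: dec_induct)
        case (step j)
        then show ?case
          using incr[of \<omega> j] elim \<open>1 \<le> i\<close> by simp
      qed simp
      then show "a * \<xi> i \<omega> \<le> a * \<xi> j \<omega>"
        using \<open>a > 0\<close> by simp
    next
      fix j
      have "a * \<xi> (2^j) \<omega> - real j * ln 2 = a * (\<Sum>k\<in>{1..<2^j}. Z k \<omega> - 1 / l k)
          + (a * (\<Sum>k\<in>{1..<2^j}. 1 / l k) - ln (real (2^j)))"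
        by (simp add: \<xi> ln_realpow sum_subtractf right_diff_distrib)
      also have "\<bar>\<dots>\<bar> \<le> a * B + C"
        using mult_left_mono[OF B[of j], of a] C[of "2^j"] \<open>a > 0\<close>
        by (intro order_trans[OF abs_triangle_ineq] add_mono) (auto simp: abs_mult)
      finally show "\<bar>a * \<xi> (2^j) \<omega> - real j * ln 2\<bar> \<le> a * B + C" .
    qed
    from num_points_growth[OF \<open>a > 0\<close> this] show ?case
      by (simp add: Liminf_le_Limsup)
  qed
qed

end
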